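(* Let $A\in\mathbb{R}^{n\times n}$ be symmetric positive semidefinite, let $m\ge1$ be an integer, $s>1$, $g(P)=[\mathrm{tr}((P^{\mathrm T}AP)^m)]^s$, and let $$H_g(P)=s\,[\mathrm{tr}((P^{\mathrm T}AP)^m)]^{s-1}H(P),\qquad H(P)=2m\,A(PP^{\mathrm T}A)^{m-1},$$ for which $\frac{\partial g(P)}{\partial P}=H_g(P)P$ for $P\in\mathbb{R}^{n\times k}$. For $P,\widetilde P\in\mathbb{R}^{n\times k}$, $$\mathrm{tr}(P^{\mathrm T}H_g(P)P)=2sm\,[\mathrm{tr}((P^{\mathrm T}AP)^m)]^s,$$ $$\mathrm{tr}(\widetilde P^{\mathrm T}H_g(P)\widetilde P)\le2[\mathrm{tr}((\widetilde P^{\mathrm T}A\widetilde P)^m)]^s+2(sm-1)[\mathrm{tr}((P^{\mathrm T}AP)^m)]^s .$$ These imply that conditions (1) and (2) of the definition of an atomic function for NEPv hold for $g$ with $H_g$, $\underline{\alpha}=2$, $\underline{\beta}=2(sm-1)$ and $\mathbb{P}=\mathrm{St}(k,n)$, and thus $g(P)=[\mathrm{tr}((P^{\mathrm T}AP)^m)]^s$ for $s>1$ is an atomic function for NEPv.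
   Context: $1\le k\le n$; $\mathrm{St}(k,n)=\{P\in\mathbb{R}^{n\times k}: P^{\mathrm T}P=I_k\}$; $\partial g(P)/\partial P$ is the $n\times k$ matrix of partial derivatives with all entries of $P$ treated as independent. Atomic function for NEPv: a function $f$ on a neighborhood $\{P\in\mathbb{R}^{n\times k}:\|P^{\mathrm T}P-I_k\|<\delta\}$ of $\mathrm{St}(k,n)$ for which there are a symmetric matrix-valued function $H_f(P)\in\mathbb{R}^{n\times n}$ for $P\in\mathrm{St}(k,n)$, a subset $\mathbb{P}\subseteq\mathrm{St}(k,n)$ and constants $\underline{\alpha}>0$, $\underline{\beta}\ge 0$, $\underline{\gamma}=\underline{\alpha}+\underline{\beta}$ such that (1) $\mathrm{tr}(P^{\mathrm T}H_f(P)P)=\underline{\gamma} f(P)$ for all $P\in\mathbb{P}$; and (2) given $P\in\mathbb{P}$ and $\widehat P\in\mathrm{St}(k,n)$, there exists $Q\in\mathrm{St}(k,k)$ such that $\widetilde P=\widehat PQ\in\mathbb{P}$ and $\mathrm{tr}(\widehat P^{\mathrm T}H_f(P)\widehat P)\le\underline{\alpha} f(\widetilde P)+\underline{\beta} f(P)$. *)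

theory Defs
  imports "HOL-Analysis.Analysis"
begin

text \<open>An $n \times k$ real matrix has type \<^typ>\<open>real^'k^'n\<close>: rows are indexed by
  \<open>'n\<close>, columns by \<open>'k\<close>.\<close>

definition stiefel :: "(real^'k^'n) set" where
  "stiefel = {P. transpose P ** P = mat 1}"

text \<open>The norm on \<^typ>\<open>real^'k^'k\<close> is the Frobenius norm; all norms on this space are
  equivalent, and the radius is always existentially quantified below.\<close>

definition stiefel_nbhd :: "real \<Rightarrow> (real^'k^'n) set" where
  "stiefel_nbhd \<delta> = {P. norm (transpose P ** P - mat 1) < \<delta>}"

definition symmetric_matrix :: "real^'n^'n \<Rightarrow> bool" where
  "symmetric_matrix A \<longleftrightarrow> transpose A = A"

definition psd_matrix :: "real^'n^'n \<Rightarrow> bool" where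
  "psd_matrix A \<longleftrightarrow> symmetric_matrix A \<and> (\<forall>x. 0 \<le> x \<bullet> (A *v x))"

text \<open>The overloaded power on \<^typ>\<open>real^'n^'n\<close> comes from the entrywise product, so the
  power with respect to \<open>**\<close> needs its own definition.\<close>

primrec matpow :: "real^'n^'n \<Rightarrow> nat \<Rightarrow> real^'n^'n" where
  "matpow A 0 = mat 1"
| "matpow A (Suc j) = A ** matpow A j"

text \<open>\<open>D\<close> is the matrix $\partial f(P)/\partial P$: each entry \<open>D $ i $ j\<close> is the partial
  derivative of \<open>f\<close> at \<open>P\<close> along the matrix unit \<open>axis i (axis j 1)\<close>.\<close>

definition has_partials :: "(real^'k^'n \<Rightarrow> real) \<Rightarrow> real^'k^'n \<Rightarrow> real^'k^'n \<Rightarrow> bool" where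
  "has_partials f D P \<longleftrightarrow>
     (\<forall>i j. ((\<lambda>t. f (P + t *\<^sub>R axis i (axis j 1))) has_real_derivative D $ i $ j) (at 0))"

definition atomic_cond1 ::
  "(real^'k^'n \<Rightarrow> real) \<Rightarrow> (real^'k^'n \<Rightarrow> real^'n^'n) \<Rightarrow> (real^'k^'n) set \<Rightarrow> real \<Rightarrow> real \<Rightarrow> bool"
where
  "atomic_cond1 f H PP \<alpha> \<beta> \<longleftrightarrow>
     (\<forall>P\<in>PP. trace (transpose P ** H P ** P) = (\<alpha> + \<beta>) * f P)"

definition atomic_cond2 ::
  "(real^'k^'n \<Rightarrow> real) \<Rightarrow> (real^'k^'n \<Rightarrow> real^'n^'n) \<Rightarrow> (real^'k^'n) set \<Rightarrow> real \<Rightarrow> real \<Rightarrow> bool"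
where
  "atomic_cond2 f H PP \<alpha> \<beta> \<longleftrightarrow>
     (\<forall>P\<in>PP. \<forall>P'\<in>stiefel. \<exists>Q\<in>(stiefel :: (real^'k^'k) set).
        P' ** Q \<in> PP \<and>
        trace (transpose P' ** H P ** P') \<le> \<alpha> * f (P' ** Q) + \<beta> * f P)"

text \<open>\<open>U\<close> is the domain of \<open>f\<close>; values of the total function \<open>f\<close> outside \<open>U\<close> are never
  used, since \<open>PP \<subseteq> stiefel \<subseteq> U\<close>.\<close>

definition atomic_NEPv_with ::
  "(real^'k^'n) set \<Rightarrow> (real^'k^'n \<Rightarrow> real) \<Rightarrow>
   (real^'k^'n \<Rightarrow> real^'n^'n) \<Rightarrow> (real^'k^'n) set \<Rightarrow> real \<Rightarrow> real \<Rightarrow> bool"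
where
  "atomic_NEPv_with U f H PP \<alpha> \<beta> \<longleftrightarrow>
     (\<exists>\<delta>>0. stiefel_nbhd \<delta> \<subseteq> U) \<and>
     (\<forall>P\<in>stiefel. symmetric_matrix (H P)) \<and>
     PP \<subseteq> stiefel \<and> \<alpha> > 0 \<and> \<beta> \<ge> 0 \<and>
     atomic_cond1 f H PP \<alpha> \<beta> \<and> atomic_cond2 f H PP \<alpha> \<beta>"

definition atomic_NEPv :: "(real^'k^'n) set \<Rightarrow> (real^'k^'n \<Rightarrow> real) \<Rightarrow> bool" where
  "atomic_NEPv U f \<longleftrightarrow> (\<exists>H PP \<alpha> \<beta>. atomic_NEPv_with U f H PP \<alpha> \<beta>)"

definition trpow :: "real^'n^'n \<Rightarrow> nat \<Rightarrow> real^'k^'n \<Rightarrow> real" where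
  "trpow A m P = trace (matpow (transpose P ** A ** P) m)"

text \<open>For positive semidefinite \<open>A\<close> the base \<open>trpow A m P\<close> is nonnegative. If it is \<open>0\<close>, then
  \<open>powr\<close> returns \<open>0\<close>, which is the usual value for the exponents \<open>s\<close> and \<open>s - 1\<close> as \<open>s > 1\<close>.\<close>

definition g_fun :: "real^'n^'n \<Rightarrow> nat \<Rightarrow> real \<Rightarrow> real^'k^'n \<Rightarrow> real" where
  "g_fun A m s P = trpow A m P powr s"

definition H_fun :: "real^'n^'n \<Rightarrow> nat \<Rightarrow> real^'k^'n \<Rightarrow> real^'n^'n" where
  "H_fun A m P = (2 * real m) *\<^sub>R (A ** matpow (P ** transpose P ** A) (m - 1))"

definition Hg_fun :: "real^'n^'n \<Rightarrow> nat \<Rightarrow> real \<Rightarrow> real^'k^'n \<Rightarrow> real^'n^'n" where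
  "Hg_fun A m s P = (s * trpow A m P powr (s - 1)) *\<^sub>R H_fun A m P"

end

theory Submission
  imports Defs
begin

text \<open>With \<open>C\<close> a symmetric square root of \<open>A\<close>, the traces in question are those of
  \<open>M\<^sup>m\<close>, \<open>N\<^sup>m\<close> and \<open>M\<^sup>m\<^sup>-\<^sup>1 N\<close> for the positive semidefinite matrices
  \<open>M = (C P)(C P)\<^sup>T\<close> and \<open>N = (C P')(C P')\<^sup>T\<close>. Diagonalising \<open>M\<close> and \<open>N\<close> by orthogonal
  matrices \<open>U\<close> and \<open>V\<close> turns all three into double sums weighted by the squared entries
  of \<open>U\<^sup>T V\<close>, so the scalar inequality \<open>m a\<^sup>m\<^sup>-\<^sup>1 b \<le> b\<^sup>m + (m - 1) a\<^sup>m\<close> applies termwise.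
  A second application of Young's inequality, with exponent \<open>s\<close>, absorbs the outer power.\<close>

section \<open>The spectral theorem for real symmetric matrices\<close>

definition diag_mat :: "('n \<Rightarrow> real) \<Rightarrow> real^'n^'n" where
  "diag_mat d = (\<chi> i j. if i = j then d i else 0)"

lemma inner_matrix_vector_left:
  fixes A :: "real^'n^'m"
  shows "(A *v x) \<bullet> y = x \<bullet> (transpose A *v y)"
  by (simp only: dot_lmul_matrix[symmetric] vector_transpose_matrix)

lemma symmetric_matrix_inner:
  fixes M :: "real^'n^'n"
  assumes "symmetric_matrix M"
  shows "x \<bullet> (M *v y) = (M *v x) \<bullet> y"
  using assms by (simp add: inner_matrix_vector_left symmetric_matrix_def)

lemma quadratic_nonneg_imp_linear_coeff_zero:
  fixes a b :: real
  assumes "\<And>t. 0 \<le> 2 * t * a + t\<^sup>2 * b" "0 \<le> b"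
  shows "a = 0"
proof (rule ccontr)
  assume "a \<noteq> 0"
  \<comment> \<open>The minimiser is -a/b, but \<open>b\<close> may be 0; dividing by b + 1 still
    gives a negative value.\<close>
  have "0 \<le> 2 * (- a / (b + 1)) * a + (- a / (b + 1))\<^sup>2 * b"
    by (rule assms)
  also have "\<dots> = - (a\<^sup>2 * (b + 2)) / (b + 1)\<^sup>2"
    using \<open>0 \<le> b\<close> by (simp add: divide_simps power2_eq_square) (simp add: algebra_simps)
  also have "\<dots> < 0"
    using \<open>a \<noteq> 0\<close> \<open>0 \<le> b\<close> by (simp add: divide_neg_pos)
  finally show False by simp
qed

text \<open>The eigenvector maximises the Rayleigh quotient on the subspace.\<close>

lemma eigenvector_in_invariant_subspace:
  fixes M :: "real^'n^'n"
  assumes sym: "symmetric_matrix M" and S: "subspace S"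
    and inv: "\<And>x. x \<in> S \<Longrightarrow> M *v x \<in> S" and nz: "x0 \<in> S" "x0 \<noteq> 0"
  obtains v c where "v \<in> S" "norm v = 1" "M *v v = c *\<^sub>R v"
proof -
  define K where "K = S \<inter> sphere 0 1"
  have "compact K"
    unfolding K_def using closed_subspace[OF S] by (simp add: closed_Int_compact)
  moreover have "x0 /\<^sub>R norm x0 \<in> K"
    using nz S by (auto simp: K_def subspace_scale)
  moreover have "continuous_on K (\<lambda>x. x \<bullet> (M *v x))"
    by (intro continuous_intros matrix_vector_mult_linear_continuous_on)
  ultimately obtain v where v: "v \<in> K" "\<And>y. y \<in> K \<Longrightarrow> y \<bullet> (M *v y) \<le> v \<bullet> (M *v v)"
    using continuous_attains_sup[of K "\<lambda>x. x \<bullet> (M *v x)"] by blast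
  define c where "c = v \<bullet> (M *v v)"
  have vS: "v \<in> S" and nv: "norm v = 1" using v by (auto simp: K_def)
  \<comment> \<open>By homogeneity, maximality of \<open>v\<close> on the unit sphere of
    \<open>S\<close> makes \<open>q\<close> nonnegative on all of \<open>S\<close>, with minimum 0
    at \<open>v\<close>.\<close>
  define q where "q = (\<lambda>x. c * (x \<bullet> x) - x \<bullet> (M *v x))"
  have q: "0 \<le> q x" if "x \<in> S" for x
  proof (cases "x = 0")
    case False
    have "x /\<^sub>R norm x \<in> K"
      using False that S by (auto simp: K_def subspace_scale)
    then have "(x /\<^sub>R norm x) \<bullet> (M *v (x /\<^sub>R norm x)) \<le> c"
      using v(2) c_def by blast
    then have "(x \<bullet> (M *v x)) / (norm x)\<^sup>2 \<le> c"
      by (simp add: matrix_vector_mult_scaleR power2_eq_square divide_inverse mult_ac)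
    then show ?thesis
      using False by (simp add: q_def power2_norm_eq_inner[symmetric] divide_simps)
  qed (simp add: q_def)
  \<comment> \<open>Half the gradient of \<open>q\<close> at \<open>v\<close>. It lies in
    \<open>S\<close> by invariance, so the minimum at \<open>v\<close> forces the linear coefficient
    of \<open>q\<close> in direction \<open>w\<close>, a multiple of \<open>w \<bullet> w\<close>,
    to vanish.\<close>
  define w where "w = c *\<^sub>R v - M *v v"
  have wS: "w \<in> S"
    unfolding w_def using S vS inv by (intro subspace_diff subspace_scale)
  have "q v = 0"
    using nv by (simp add: q_def c_def norm_eq_1)
  have "q (v + t *\<^sub>R w) = q v + 2 * t * (w \<bullet> w) + t\<^sup>2 * q w" for t
  proof -
    have e1: "(v + t *\<^sub>R w) \<bullet> (v + t *\<^sub>R w) = v \<bullet> v + 2 * t * (v \<bullet> w) + t * t * (w \<bullet> w)"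
      by (simp add: inner_add_left inner_add_right inner_commute[of w v] distrib_left)
    have e2: "(v + t *\<^sub>R w) \<bullet> (M *v (v + t *\<^sub>R w))
        = v \<bullet> (M *v v) + 2 * t * (w \<bullet> (M *v v)) + t * t * (w \<bullet> (M *v w))"
      using symmetric_matrix_inner[OF sym, of v w]
      by (simp add: inner_add_left inner_add_right matrix_vector_right_distrib
          matrix_vector_mult_scaleR inner_commute[of "M *v v" w] distrib_left)
    have "w \<bullet> w = w \<bullet> (c *\<^sub>R v - M *v v)" by (simp only: w_def)
    then have e3: "w \<bullet> w = c * (v \<bullet> w) - w \<bullet> (M *v v)"
      by (simp add: inner_diff_right inner_commute[of w v])
    have "q v + 2 * t * (w \<bullet> w) + t\<^sup>2 * q w
        = q v + 2 * t * (c * (v \<bullet> w) - w \<bullet> (M *v v)) + t\<^sup>2 * q w"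
      by (subst e3) (rule refl)
    also have "\<dots> = q (v + t *\<^sub>R w)"
      unfolding q_def e1 e2 power2_eq_square
      by (simp only: distrib_left right_diff_distrib mult.assoc mult.left_commute)
    finally show ?thesis by simp
  qed
  moreover have "0 \<le> q (v + t *\<^sub>R w)" for t
    using S vS wS by (intro q subspace_add subspace_scale)
  ultimately have "w \<bullet> w = 0"
    using \<open>q v = 0\<close> q[OF wS] by (intro quadratic_nonneg_imp_linear_coeff_zero[of _ "q w"]) auto
  then have "M *v v = c *\<^sub>R v" by (simp add: w_def)
  with vS nv show ?thesis by (rule that)
qed

text \<open>The eigenvectors are found one at a time: symmetry makes the orthogonal complement of
  those already found invariant under \<open>M\<close>, so it contains a further one as long as it
  is nonzero.\<close>

lemma orthonormal_eigenvectors: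
  fixes M :: "real^'n^'n"
  assumes sym: "symmetric_matrix M"
  shows "k \<le> CARD('n) \<Longrightarrow> \<exists>B. finite B \<and> card B = k \<and> pairwise orthogonal B \<and>
    (\<forall>b\<in>B. norm b = 1 \<and> (\<exists>c. M *v b = c *\<^sub>R b))"
proof (induction k)
  case 0
  show ?case by (intro exI[of _ "{}"]) simp
next
  case (Suc k)
  then obtain B where B: "finite B" "card B = k" "pairwise orthogonal B"
    "\<forall>b\<in>B. norm b = 1 \<and> (\<exists>c. M *v b = c *\<^sub>R b)" by auto
  define S where "S = {x. \<forall>b\<in>B. b \<bullet> x = 0}"
  have "subspace S"
    unfolding S_def subspace_def by (auto simp: inner_add_right)
  moreover have "M *v x \<in> S" if "x \<in> S" for x
    unfolding S_def
  proof (intro CollectI ballI)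
    fix b assume "b \<in> B"
    then obtain c where "M *v b = c *\<^sub>R b" using B by blast
    then show "b \<bullet> (M *v x) = 0"
      using that \<open>b \<in> B\<close> by (simp add: symmetric_matrix_inner[OF sym] S_def)
  qed
  moreover
  \<comment> \<open>Fewer vectors than the dimension leave a nonzero vector orthogonal to all of
    them.\<close>
  have "dim B < DIM(real^'n)"
    using dim_le_card'[OF B(1)] B(2) Suc.prems by simp
  then obtain x where "x \<noteq> 0" "\<And>y. y \<in> span B \<Longrightarrow> orthogonal x y"
    by (rule orthogonal_to_subspace_exists) (rule that)
  then have "x \<in> S" "x \<noteq> 0"
    by (auto simp: S_def orthogonal_def span_base inner_commute)
  ultimately obtain v c where v: "v \<in> S" "norm v = 1" "M *v v = c *\<^sub>R v"
    using eigenvector_in_invariant_subspace[OF sym] by metis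
  have "v \<notin> B" using v by (force simp: S_def)
  moreover have "pairwise orthogonal (insert v B)"
    using B(3) v(1) by (auto simp: pairwise_insert orthogonal_def S_def inner_commute)
  ultimately show ?case
    using B v by (intro exI[of _ "insert v B"]) auto
qed

theorem spectral_theorem_symmetric_matrix:
  fixes M :: "real^'n^'n"
  assumes sym: "symmetric_matrix M"
  obtains U d where "orthogonal_matrix U" "M = U ** diag_mat d ** transpose U"
proof -
  obtain B where B: "finite B" "card B = CARD('n)" "pairwise orthogonal B"
    "\<forall>b\<in>B. norm b = 1 \<and> (\<exists>c. M *v b = c *\<^sub>R b)"
    using orthonormal_eigenvectors[OF sym, of "CARD('n)"] by blast
  \<comment> \<open>Indexing the eigenvectors by the index type lets them serve as the columns of
    \<open>U\<close>; the eigenvalue equations, read column by column, become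
    \<open>M ** U = U ** diag_mat d\<close>.\<close>
  obtain e where e: "bij_betw e (UNIV :: 'n set) B"
    using B by (metis finite finite_same_card_bij)
  have eB: "e j \<in> B" for j using e by (auto simp: bij_betw_def)
  have "\<forall>j. \<exists>c. M *v e j = c *\<^sub>R e j" using B(4) eB by blast
  then obtain d where d: "\<And>j. M *v e j = d j *\<^sub>R e j" by metis
  define U :: "real^'n^'n" where "U = (\<chi> i j. e j $ i)"
  have col: "column j U = e j" for j by (simp add: U_def column_def)
  have "e i \<bullet> e j = (if i = j then 1 else 0)" for i j
  proof (cases "i = j")
    case True
    have "norm (e i) = 1" using B(4) eB by blast
    with True show ?thesis by (simp add: norm_eq_1)
  next
    case False
    then have "e i \<noteq> e j" using e by (auto simp: bij_betw_def inj_def)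
    then show ?thesis using False B(3) eB by (auto simp: pairwise_def orthogonal_def)
  qed
  then have "transpose U ** U = mat 1"
    by (simp add: matrix_mult_transpose_dot_column col mat_def vec_eq_iff)
  then have U: "orthogonal_matrix U" by (simp add: orthogonal_matrix)
  have "(M ** U) $ i $ j = (U ** diag_mat d) $ i $ j" for i j
  proof -
    have "(M ** U) $ i $ j = (M *v e j) $ i"
      by (simp add: matrix_matrix_mult_def matrix_vector_mult_def U_def)
    also have "\<dots> = (U ** diag_mat d) $ i $ j"
      by (simp add: d matrix_matrix_mult_def diag_mat_def U_def if_distrib cong: if_cong)
    finally show ?thesis .
  qed
  then have "M ** U = U ** diag_mat d" by (simp add: vec_eq_iff)
  then have "M ** (U ** transpose U) = U ** diag_mat d ** transpose U"
    by (simp add: matrix_mul_assoc)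
  then have "M = U ** diag_mat d ** transpose U"
    using U by (simp add: orthogonal_matrix_def)
  with U show ?thesis by (rule that)
qed

section \<open>Diagonal matrices, nonnegative eigenvalues and square roots\<close>

lemma diag_mat_vector: "diag_mat d *v axis i 1 = d i *\<^sub>R axis i 1"
  unfolding matrix_vector_mult_basis
  by (auto simp: column_def diag_mat_def axis_def vec_eq_iff)

lemma transpose_diag_mat: "transpose (diag_mat d) = diag_mat d"
  by (auto simp: diag_mat_def transpose_def vec_eq_iff)

lemma diag_mat_mult_nth: "(diag_mat d ** X) $ i $ j = d i * X $ i $ j"
proof -
  have "(diag_mat d ** X) $ i $ j = (\<Sum>k\<in>UNIV. if k = i then d i * X $ k $ j else 0)"
    by (simp only: matrix_matrix_mult_def diag_mat_def vec_lambda_beta, intro sum.cong) auto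
  then show ?thesis by simp
qed

lemma diag_mat_mult: "diag_mat d ** diag_mat e = diag_mat (\<lambda>i. d i * e i)"
  unfolding vec_eq_iff diag_mat_mult_nth by (simp add: diag_mat_def)

text \<open>Each \<open>d i\<close> is the value of the quadratic form of \<open>M\<close> at the
  i-th column of \<open>U\<close>, a unit vector.\<close>

lemma psd_matrix_diagonalization:
  fixes M :: "real^'n^'n"
  assumes psd: "psd_matrix M"
  obtains U d where "orthogonal_matrix U" "M = U ** diag_mat d ** transpose U" "\<And>i. 0 \<le> d i"
proof -
  obtain U d where U: "orthogonal_matrix U" and M: "M = U ** diag_mat d ** transpose U"
    using spectral_theorem_symmetric_matrix psd psd_matrix_def by blast
  have "0 \<le> d i" for i
  proof -
    define x where "x = U *v axis i 1"
    have UU: "transpose U ** U = mat 1" using U by (simp add: orthogonal_matrix_def)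
    have "M *v x = U *v (diag_mat d *v ((transpose U ** U) *v axis i 1))"
      by (simp add: M x_def matrix_vector_mul_assoc matrix_mul_assoc)
    also have "\<dots> = d i *\<^sub>R x"
      by (simp add: UU diag_mat_vector matrix_vector_mult_scaleR x_def)
    finally have "M *v x = d i *\<^sub>R x" .
    moreover have "x \<bullet> x = 1"
      by (simp only: x_def inner_matrix_vector_left matrix_vector_mul_assoc UU
          matrix_vector_mul_lid inner_axis_axis) simp
    moreover have "0 \<le> x \<bullet> (M *v x)" using psd by (simp add: psd_matrix_def)
    ultimately show ?thesis by simp
  qed
  with U M show ?thesis by (rule that)
qed

text \<open>Square roots of the eigenvalues are taken in the same eigenbasis.\<close>

lemma psd_matrix_sqrt:
  fixes A :: "real^'n^'n"
  assumes "psd_matrix A"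
  obtains C where "transpose C = C" "C ** C = A"
proof -
  obtain U d where U: "orthogonal_matrix U" and A: "A = U ** diag_mat d ** transpose U"
    and d: "\<And>i. 0 \<le> d i"
    using psd_matrix_diagonalization[OF assms] by blast
  define C where "C = U ** diag_mat (\<lambda>i. sqrt (d i)) ** transpose U"
  have "C ** C = U ** diag_mat (\<lambda>i. sqrt (d i)) ** (transpose U ** U)
      ** diag_mat (\<lambda>i. sqrt (d i)) ** transpose U"
    by (simp add: C_def matrix_mul_assoc)
  also have "\<dots> = U ** (diag_mat (\<lambda>i. sqrt (d i)) ** diag_mat (\<lambda>i. sqrt (d i))) ** transpose U"
    using U by (simp add: orthogonal_matrix_def matrix_mul_assoc)
  also have "\<dots> = A"
    using d by (simp add: diag_mat_mult A)
  finally have "C ** C = A" .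
  moreover have "transpose C = C"
    by (simp add: C_def matrix_transpose_mul transpose_diag_mat matrix_mul_assoc)
  ultimately show ?thesis using that by blast
qed

lemma psd_matrix_gram: "psd_matrix (X ** transpose X)"
proof -
  have "0 \<le> x \<bullet> ((X ** transpose X) *v x)" for x
  proof -
    have "x \<bullet> ((X ** transpose X) *v x) = (transpose X *v x) \<bullet> (transpose X *v x)"
      by (simp only: inner_matrix_vector_left transpose_transpose matrix_vector_mul_assoc)
    then show ?thesis by simp
  qed
  then show ?thesis
    by (simp add: psd_matrix_def symmetric_matrix_def matrix_transpose_mul)
qed

section \<open>Traces of matrix powers\<close>

lemma matpow_diagonalization:
  assumes "orthogonal_matrix U"
  shows "matpow (U ** diag_mat d ** transpose U) j = U ** diag_mat (\<lambda>i. d i ^ j) ** transpose U"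
proof (induction j)
  case 0
  have "diag_mat (\<lambda>i. 1) = (mat 1 :: real^'a^'a)"
    by (simp add: diag_mat_def mat_def)
  then show ?case using assms by (simp add: orthogonal_matrix_def)
next
  case (Suc j)
  have "matpow (U ** diag_mat d ** transpose U) (Suc j)
      = U ** diag_mat d ** (transpose U ** U) ** diag_mat (\<lambda>i. d i ^ j) ** transpose U"
    by (simp add: Suc matrix_mul_assoc)
  also have "\<dots> = U ** (diag_mat d ** diag_mat (\<lambda>i. d i ^ j)) ** transpose U"
    using assms by (simp add: orthogonal_matrix_def matrix_mul_assoc)
  finally show ?case by (simp add: diag_mat_mult)
qed

text \<open>Cyclicity reduces the trace to that of D W E W^T with W = U^T V. The weights are
  squares, so scalar inequalities between eigenvalues can be summed to inequalities between
  traces.\<close>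

lemma trace_diagonalizations:
  fixes U V :: "real^'n^'n"
  shows "trace ((U ** diag_mat d ** transpose U) ** (V ** diag_mat e ** transpose V))
    = (\<Sum>i\<in>UNIV. \<Sum>j\<in>UNIV. d i * e j * ((transpose U ** V) $ i $ j)\<^sup>2)"
proof -
  define W where "W = transpose U ** V"
  have "trace ((U ** diag_mat d ** transpose U) ** (V ** diag_mat e ** transpose V))
      = trace (U ** (diag_mat d ** W ** diag_mat e ** transpose V))"
    by (simp add: W_def matrix_mul_assoc)
  also have "\<dots> = trace (diag_mat d ** W ** (diag_mat e ** transpose W))"
    by (subst trace_mul_sym) (simp add: W_def matrix_transpose_mul matrix_mul_assoc)
  also have "\<dots> = (\<Sum>i\<in>UNIV. \<Sum>j\<in>UNIV. d i * e j * (W $ i $ j)\<^sup>2)"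
    by (simp add: trace_def matrix_matrix_mult_def[of "diag_mat d ** W"] diag_mat_mult_nth
        transpose_def power2_eq_square mult_ac)
  finally show ?thesis by (simp add: W_def)
qed

lemma trace_matpow_nonneg:
  assumes "psd_matrix M"
  shows "0 \<le> trace (matpow M j)"
proof -
  obtain U d where U: "orthogonal_matrix U" and M: "M = U ** diag_mat d ** transpose U"
    and d: "\<And>i. 0 \<le> d i"
    using psd_matrix_diagonalization[OF assms] by blast
  \<comment> \<open>The identity factor brings the trace into the two-factor form expanded
    above.\<close>
  have "trace (matpow M j) = trace (matpow M j ** matpow M 0)" by simp
  also have "\<dots> \<ge> 0"
    unfolding M matpow_diagonalization[OF U] trace_diagonalizations
    using d by (intro sum_nonneg) simp
  finally show ?thesis .
qed

section \<open>Young's inequality for numbers and for traces\<close>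

text \<open>Induction: the previous case times \<open>a\<close> is added to (a - b)(a^(j+1) -
  b^(j+1)) >= 0, whose factors have the same sign.\<close>

lemma power_Young:
  fixes a b :: real
  assumes "0 \<le> a" "0 \<le> b"
  shows "real (Suc j) * a ^ j * b \<le> b ^ Suc j + real j * a ^ Suc j"
proof (induction j)
  case (Suc j)
  have "0 \<le> (a - b) * (a ^ Suc j - b ^ Suc j)"
  proof (cases "a \<le> b")
    case True
    then have "a ^ Suc j \<le> b ^ Suc j" using assms by (intro power_mono)
    with True show ?thesis by (intro mult_nonpos_nonpos) auto
  next
    case False
    then have "b ^ Suc j \<le> a ^ Suc j" using assms by (intro power_mono) auto
    with False show ?thesis by (intro mult_nonneg_nonneg) auto
  qed
  moreover have "a * (real (Suc j) * a ^ j * b) \<le> a * (b ^ Suc j + real j * a ^ Suc j)"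
    using Suc assms(1) by (rule mult_left_mono)
  ultimately show ?case by (simp add: algebra_simps)
qed simp

lemma trace_matpow_Young:
  fixes M N :: "real^'n^'n"
  assumes "psd_matrix M" "psd_matrix N"
  shows "real (Suc j) * trace (matpow M j ** N)
    \<le> trace (matpow N (Suc j)) + real j * trace (matpow M (Suc j))"
proof -
  obtain U d where U: "orthogonal_matrix U" and M: "M = U ** diag_mat d ** transpose U"
    and d: "\<And>i. 0 \<le> d i"
    using psd_matrix_diagonalization[OF assms(1)] by blast
  obtain V e where V: "orthogonal_matrix V" and N: "N = V ** diag_mat e ** transpose V"
    and e: "\<And>i. 0 \<le> e i"
    using psd_matrix_diagonalization[OF assms(2)] by blast
  define W where "W = transpose U ** V"
  have tr: "trace (matpow M p ** matpow N q)
      = (\<Sum>i\<in>UNIV. \<Sum>j\<in>UNIV. d i ^ p * e j ^ q * (W $ i $ j)\<^sup>2)" for p q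
    unfolding M N matpow_diagonalization[OF U] matpow_diagonalization[OF V] W_def
    by (rule trace_diagonalizations)
  \<comment> \<open>The exponents 0 and 1 bring all three traces into the form \<open>tr\<close>, so
    that they share the same weights.\<close>
  have "real (Suc j) * trace (matpow M j ** matpow N 1)
    \<le> trace (matpow M 0 ** matpow N (Suc j)) + real j * trace (matpow M (Suc j) ** matpow N 0)"
    unfolding tr sum_distrib_left sum.distrib[symmetric]
  proof (intro sum_mono)
    fix i k
    have "(real (Suc j) * d i ^ j * e k) * (W $ i $ k)\<^sup>2
      \<le> (e k ^ Suc j + real j * d i ^ Suc j) * (W $ i $ k)\<^sup>2"
      by (intro mult_right_mono power_Young d e) simp
    then show "real (Suc j) * (d i ^ j * e k ^ 1 * (W $ i $ k)\<^sup>2)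
      \<le> d i ^ 0 * e k ^ Suc j * (W $ i $ k)\<^sup>2 + real j * (d i ^ Suc j * e k ^ 0 * (W $ i $ k)\<^sup>2)"
      by (simp add: algebra_simps)
  qed
  then show ?thesis by simp
qed

lemma powr_Young:
  fixes u v s :: real
  assumes "0 \<le> u" "0 \<le> v" "1 < s"
  shows "s * u powr (s - 1) * v \<le> v powr s + (s - 1) * u powr s"
proof -
  \<comment> \<open>Young's inequality with the conjugate exponents s and s/(s - 1); multiplying by
    \<open>s\<close> gives the claim.\<close>
  have "v * u powr (s - 1) \<le> v powr s / s + (u powr (s - 1)) powr (s / (s - 1)) / (s / (s - 1))"
    using assms by (intro Youngs_inequality) (auto simp: divide_simps)
  also have "(u powr (s - 1)) powr (s / (s - 1)) = u powr s"
    using assms by (simp add: powr_powr)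
  finally show ?thesis
    using assms by (simp add: divide_simps) (simp add: algebra_simps)
qed

section \<open>Commutation and trace identities for matrix powers\<close>

text \<open>The push-through identity. The factors may be rectangular, so it exchanges powers of n x
  n and k x k matrices.\<close>

lemma matpow_mult_commute: "matpow (X ** Y) j ** X = X ** matpow (Y ** X) j"
proof (induction j)
  case (Suc j)
  have "matpow (X ** Y) (Suc j) ** X = X ** Y ** (matpow (X ** Y) j ** X)"
    by (simp add: matrix_mul_assoc)
  then show ?case by (simp add: Suc matrix_mul_assoc)
qed simp

lemma matpow_Suc_right: "matpow A (Suc j) = matpow A j ** A"
  using matpow_mult_commute[of A "mat 1" j] by simp

lemma transpose_matpow: "transpose (matpow A j) = matpow (transpose A) j"
proof (induction j)
  case (Suc j)
  then show ?case
    unfolding matpow_Suc_right[of "transpose A"] by (simp add: matrix_transpose_mul)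
qed (simp add: transpose_mat)

text \<open>Push-through followed by cyclicity. The exponent is positive because at exponent 0 the
  traces are the two dimensions, which may differ.\<close>

lemma trace_matpow_swap: "trace (matpow (X ** Y) (Suc j)) = trace (matpow (Y ** X) (Suc j))"
proof -
  have "trace (matpow (X ** Y) (Suc j)) = trace (matpow (X ** Y) j ** X ** Y)"
    by (simp only: matpow_Suc_right matrix_mul_assoc)
  also have "\<dots> = trace (Y ** (X ** matpow (Y ** X) j))"
    by (simp add: matpow_mult_commute trace_mul_sym[of _ Y])
  finally show ?thesis by (simp add: matrix_mul_assoc)
qed

lemma trace_scaleR: "trace (c *\<^sub>R A) = c * trace (A :: real^'n^'n)"
  by (simp add: trace_def sum_distrib_left)

lemma trace_transpose: "trace (transpose A) = trace A"
  by (simp add: trace_def transpose_def)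

section \<open>Differentiation of matrix powers\<close>

lemma matrix_add_rdistrib:
  fixes A B :: "'a::semiring_1^'n^'m"
  shows "(A + B) ** C = A ** C + B ** C"
  by (simp add: matrix_matrix_mult_def vec_eq_iff distrib_right sum.distrib)

lemma bounded_bilinear_matrix_mult:
  "bounded_bilinear ((**) :: real^'n^'m \<Rightarrow> real^'p^'n \<Rightarrow> real^'p^'m)"
  unfolding bilinear_conv_bounded_bilinear[symmetric] bilinear_def
  by (auto intro!: linearI simp: matrix_add_ldistrib matrix_add_rdistrib matrix_scalar_ac
      scalar_matrix_assoc)

lemma bounded_linear_trace: "bounded_linear (trace :: real^'n^'n \<Rightarrow> real)"
  by (intro linear_conv_bounded_linear[THEN iffD1] linearI) (simp_all add: trace_add trace_scaleR)

text \<open>\<open>B x\<close> and \<open>B'\<close> need not commute, so the derivative of the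
  power is a sum of mixed products; against a power of \<open>B x\<close> under the trace they all
  agree by cyclicity. The free \<open>k\<close> carries the induction. For \<open>m = 0\<close> the
  truncated exponent is harmless, as its coefficient is 0.\<close>

lemma has_vector_derivative_matpow:
  fixes B :: "real \<Rightarrow> real^'n^'n"
  assumes B: "(B has_vector_derivative B') (at x)"
  shows "\<exists>D. ((\<lambda>t. matpow (B t) m) has_vector_derivative D) (at x) \<and>
    (\<forall>k. trace (matpow (B x) k ** D) = real m * trace (matpow (B x) (k + m - 1) ** B'))"
proof (induction m)
  case 0
  show ?case by (auto intro!: exI[of _ 0] simp: trace_def)
next
  case (Suc m)
  then obtain D where D: "((\<lambda>t. matpow (B t) m) has_vector_derivative D) (at x)"
    and tr: "\<And>k. trace (matpow (B x) k ** D) = real m * trace (matpow (B x) (k + m - 1) ** B')"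
    by blast
  have pow_add: "matpow (B x) m ** matpow (B x) k = matpow (B x) (k + m)" for k
    by (induction m) (simp_all add: matrix_mul_assoc[symmetric])
  have "trace (matpow (B x) k ** (B x ** D + B' ** matpow (B x) m))
      = real (Suc m) * trace (matpow (B x) (k + Suc m - 1) ** B')" for k
  proof -
    \<comment> \<open>The extra factor \<open>B x\<close> is absorbed by taking the induction
      hypothesis at \<open>Suc k\<close>.\<close>
    have "trace (matpow (B x) k ** (B x ** D)) = real m * trace (matpow (B x) (k + m) ** B')"
      using tr[of "Suc k"] by (simp only: matpow_Suc_right matrix_mul_assoc) simp
    moreover have "trace (matpow (B x) k ** (B' ** matpow (B x) m))
        = trace (matpow (B x) (k + m) ** B')"
      by (subst matrix_mul_assoc, subst trace_mul_sym) (simp add: matrix_mul_assoc pow_add)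
    ultimately show ?thesis
      by (simp add: matrix_add_ldistrib trace_add algebra_simps)
  qed
  moreover have "((\<lambda>t. matpow (B t) (Suc m)) has_vector_derivative
      B x ** D + B' ** matpow (B x) m) (at x)"
    using bounded_bilinear.has_vector_derivative[OF bounded_bilinear_matrix_mult B D] by simp
  ultimately show ?case by blast
qed

lemma has_real_derivative_trace_matpow:
  fixes B :: "real \<Rightarrow> real^'n^'n"
  assumes "(B has_vector_derivative B') (at x)"
  shows "((\<lambda>t. trace (matpow (B t) m)) has_real_derivative
    real m * trace (matpow (B x) (m - 1) ** B')) (at x)"
proof -
  obtain D where D: "((\<lambda>t. matpow (B t) m) has_vector_derivative D) (at x)"
    and tr: "\<And>k. trace (matpow (B x) k ** D) = real m * trace (matpow (B x) (k + m - 1) ** B')"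
    using has_vector_derivative_matpow[OF assms] by blast
  show ?thesis
    using bounded_linear.has_vector_derivative[OF bounded_linear_trace D] tr[of 0]
    by (simp add: has_real_derivative_iff_has_vector_derivative)
qed

lemma has_real_derivative_powr_nonneg:
  fixes f :: "real \<Rightarrow> real"
  assumes f: "(f has_real_derivative D) (at x)" and nn: "\<And>y. 0 \<le> f y" and s: "1 < s"
  shows "((\<lambda>y. f y powr s) has_real_derivative s * f x powr (s - 1) * D) (at x)"
proof (cases "f x = 0")
  case False
  then have "0 < f x" using nn[of x] by simp
  from DERIV_fun_powr[OF f this] show ?thesis by simp
next
  case True
  \<comment> \<open>At a zero of \<open>f\<close> the chain rule for \<open>powr\<close> does not
    apply. There the difference quotient of f^s is that of \<open>f\<close> times f^(s - 1), and the
    last factor tends to 0 since s > 1.\<close>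
  have "f \<midarrow>x\<rightarrow> 0"
    using DERIV_isCont[OF f] True by (simp add: isCont_def)
  then have "(\<lambda>y. f y powr (s - 1)) \<midarrow>x\<rightarrow> 0"
    using s nn by (intro tendsto_zero_powrI[where b = "s - 1"]) auto
  moreover have "(\<lambda>y. (f y - f x) / (y - x)) \<midarrow>x\<rightarrow> D"
    using f by (simp add: has_field_derivative_iff)
  ultimately have "(\<lambda>y. (f y - f x) / (y - x) * f y powr (s - 1)) \<midarrow>x\<rightarrow> D * 0"
    by (intro tendsto_mult)
  moreover have "f y * f y powr (s - 1) = f y powr s" for y
    using nn[of y] powr_mult_base[of "f y" "s - 1"] by simp
  ultimately show ?thesis
    using s by (simp add: has_field_derivative_iff True)
qed

section \<open>The atomic function\<close>

text \<open>Pushing the last \<open>P\<close> through the power produces powers of P^T A P, the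
  matrix inside \<open>trpow\<close>.\<close>

lemma H_fun_mult:
  "H_fun A (Suc j) P ** P = (2 * real (Suc j)) *\<^sub>R (A ** P ** matpow (transpose P ** A ** P) j)"
proof -
  have "matpow (P ** transpose P ** A) j ** P = P ** matpow (transpose P ** A ** P) j"
    using matpow_mult_commute[of P "transpose P ** A" j] by (simp add: matrix_mul_assoc)
  then have "A ** matpow (P ** transpose P ** A) j ** P = A ** P ** matpow (transpose P ** A ** P) j"
    by (metis matrix_mul_assoc)
  then show ?thesis
    by (simp add: H_fun_def scalar_matrix_assoc[symmetric] del: of_nat_Suc)
qed

lemma trace_H_fun:
  "trace (transpose P ** H_fun A (Suc j) P ** P) = 2 * real (Suc j) * trpow A (Suc j) P"
proof -
  have "transpose P ** H_fun A (Suc j) P ** P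
      = (2 * real (Suc j)) *\<^sub>R (transpose P ** (A ** P ** matpow (transpose P ** A ** P) j))"
    by (simp only: matrix_mul_assoc[of _ _ P, symmetric] H_fun_mult matrix_scalar_ac
        scalar_matrix_assoc[symmetric])
  then show ?thesis
    by (simp add: trace_scaleR trpow_def matrix_mul_assoc del: of_nat_Suc)
qed

text \<open>Transposition reverses the product to (A P P^T)^j A, and push-through restores the
  order.\<close>

lemma symmetric_matrix_H_fun:
  assumes "symmetric_matrix A"
  shows "symmetric_matrix (H_fun A m P)"
proof -
  have A: "transpose A = A" using assms by (simp add: symmetric_matrix_def)
  have "transpose (A ** matpow (P ** transpose P ** A) j) = A ** matpow (P ** transpose P ** A) j" for j
    by (simp add: matrix_transpose_mul transpose_matpow A matpow_mult_commute)
  moreover have "transpose (c *\<^sub>R X) = c *\<^sub>R transpose X" for c and X :: "real^'a^'a"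
    by (simp add: transpose_def vec_eq_iff)
  ultimately show ?thesis by (simp add: symmetric_matrix_def H_fun_def)
qed

text \<open>Swapping the factors of (C P)^T (C P) gives the n x n Gram matrix to which
  \<open>trace_matpow_Young\<close> is applied.\<close>

lemma trpow_sqrt:
  assumes C: "transpose C = C" "C ** C = A"
  shows "trpow A (Suc j) P = trace (matpow ((C ** P) ** transpose (C ** P)) (Suc j))"
proof -
  have "transpose P ** A ** P = transpose (C ** P) ** (C ** P)"
    by (simp add: matrix_transpose_mul C(1) matrix_mul_assoc flip: C(2))
  then show ?thesis unfolding trpow_def by (metis trace_matpow_swap)
qed

lemma trpow_nonneg:
  assumes "psd_matrix A"
  shows "0 \<le> trpow A (Suc j) P"
proof -
  obtain C where C: "transpose C = C" "C ** C = A"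
    using psd_matrix_sqrt[OF assms] by blast
  show ?thesis
    unfolding trpow_sqrt[OF C] by (intro trace_matpow_nonneg psd_matrix_gram)
qed

text \<open>With $A = C^2$, $M = CPP^{\mathrm T}C$ and $N = CP'P'^{\mathrm T}C$ the left-hand side
  is $2m\,\mathrm{tr}(M^{m-1}N)$.\<close>

lemma trace_H_fun_le:
  assumes "psd_matrix A"
  shows "trace (transpose P' ** H_fun A (Suc j) P ** P')
    \<le> 2 * trpow A (Suc j) P' + 2 * real j * trpow A (Suc j) P"
proof -
  obtain C where C: "transpose C = C" "C ** C = A"
    using psd_matrix_sqrt[OF assms] by blast
  define M where "M = (C ** P) ** transpose (C ** P)"
  define N where "N = (C ** P') ** transpose (C ** P')"
  \<comment> \<open>One of the two factors \<open>C\<close> of \<open>A\<close> passes through the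
    power and turns it into a power of \<open>M\<close>; the outer factors \<open>C\<close> then
    join \<open>P'\<close> on both sides.\<close>
  have MC: "C ** matpow (P ** transpose P ** A) j = matpow M j ** C"
    using matpow_mult_commute[of C "P ** transpose P ** C" j]
    by (simp add: M_def matrix_transpose_mul C(1) matrix_mul_assoc flip: C(2))
  have "A ** matpow (P ** transpose P ** A) j = C ** (C ** matpow (P ** transpose P ** A) j)"
    by (simp add: matrix_mul_assoc C(2))
  then have "A ** matpow (P ** transpose P ** A) j = C ** matpow M j ** C"
    unfolding MC by (simp add: matrix_mul_assoc)
  then have "transpose P' ** H_fun A (Suc j) P ** P'
      = (2 * real (Suc j)) *\<^sub>R (transpose (C ** P') ** (matpow M j ** (C ** P')))"
    by (simp add: H_fun_def matrix_scalar_ac scalar_matrix_assoc[symmetric] matrix_transpose_mul C(1)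
        matrix_mul_assoc del: of_nat_Suc)
  also have "trace \<dots> = 2 * (real (Suc j) * trace (matpow M j ** N))"
    unfolding trace_scaleR trace_mul_sym[of "transpose (C ** P')"] N_def
    by (simp only: matrix_mul_assoc mult.assoc)
  also have "\<dots> \<le> 2 * (trace (matpow N (Suc j)) + real j * trace (matpow M (Suc j)))"
    by (intro mult_left_mono trace_matpow_Young) (simp_all add: M_def N_def psd_matrix_gram)
  finally show ?thesis
    unfolding trpow_sqrt[OF C] M_def N_def by (simp add: algebra_simps)
qed

section \<open>From \<open>H_fun\<close> to \<open>Hg_fun\<close>: the outer power\<close>

lemma trace_Hg_fun:
  "trace (transpose P' ** Hg_fun A m s P ** P')
    = s * trpow A m P powr (s - 1) * trace (transpose P' ** H_fun A m P ** P')"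
  by (simp add: Hg_fun_def matrix_scalar_ac scalar_matrix_assoc[symmetric] trace_scaleR)

lemma trace_Hg_fun_self:
  assumes "psd_matrix A"
  shows "trace (transpose P ** Hg_fun A (Suc j) s P ** P)
    = 2 * s * real (Suc j) * trpow A (Suc j) P powr s"
proof -
  have "trpow A (Suc j) P * trpow A (Suc j) P powr (s - 1) = trpow A (Suc j) P powr s"
    using powr_mult_base[OF trpow_nonneg[OF assms], of j P "s - 1"] by simp
  then show ?thesis
    unfolding trace_Hg_fun trace_H_fun by (simp add: mult_ac del: of_nat_Suc)
qed

text \<open>The bound for \<open>H_fun\<close> is scaled by s u^(s - 1) and the mixed term split by
  \<open>powr_Young\<close>. The coefficients of u^s add up to 2(s - 1) + 2js = 2(s(j + 1) -
  1).\<close>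

lemma trace_Hg_fun_le:
  assumes "psd_matrix A" "1 < s"
  shows "trace (transpose P' ** Hg_fun A (Suc j) s P ** P')
    \<le> 2 * trpow A (Suc j) P' powr s + 2 * (s * real (Suc j) - 1) * trpow A (Suc j) P powr s"
proof -
  define u where "u = trpow A (Suc j) P"
  define v where "v = trpow A (Suc j) P'"
  have nn: "0 \<le> u" "0 \<le> v" using trpow_nonneg[OF assms(1)] by (auto simp: u_def v_def)
  have "trace (transpose P' ** Hg_fun A (Suc j) s P ** P')
      \<le> s * u powr (s - 1) * (2 * v + 2 * real j * u)"
    unfolding trace_Hg_fun u_def v_def
    using assms by (intro mult_left_mono trace_H_fun_le) auto
  also have "\<dots> = 2 * (s * u powr (s - 1) * v) + 2 * real j * s * (u * u powr (s - 1))"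
    by (simp add: algebra_simps)
  also have "\<dots> \<le> 2 * (v powr s + (s - 1) * u powr s) + 2 * real j * s * u powr s"
    using powr_Young[OF nn assms(2)] powr_mult_base[OF nn(1), of "s - 1"] by simp
  finally show ?thesis by (simp add: u_def v_def algebra_simps)
qed

section \<open>Partial derivatives\<close>

lemma trace_transpose_unit_mult:
  fixes X :: "real^'k^'n"
  shows "trace (transpose (axis i (axis j 1)) ** X) = X $ i $ j"
proof -
  have "trace (transpose (axis i (axis j 1)) ** X)
      = (\<Sum>a\<in>UNIV. \<Sum>b\<in>UNIV. if b = i then (if a = j then X $ b $ a else 0) else 0)"
    by (simp only: trace_def matrix_matrix_mult_def transpose_def vec_lambda_beta,
        intro sum.cong refl) (auto simp: axis_def)
  then show ?thesis by simp
qed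

text \<open>Along a matrix unit \<open>E\<close>, the product rule for P^T A P gives two terms, and
  each contributes the same entry of \<open>X\<close>; this is the factor 2 in
  \<open>H_fun\<close>.\<close>

lemma has_partials_trpow:
  fixes A :: "real^'n^'n" and P :: "real^'k^'n"
  assumes A: "symmetric_matrix A"
  shows "has_partials (trpow A (Suc m)) (H_fun A (Suc m) P ** P) P"
  unfolding has_partials_def
proof (intro allI)
  fix i j
  define E :: "real^'k^'n" where "E = axis i (axis j 1)"
  define X where "X = A ** P ** matpow (transpose P ** A ** P) m"
  have tA: "transpose A = A" using A by (simp add: symmetric_matrix_def)
  let ?R = "\<lambda>t. P + t *\<^sub>R E"
  have R: "(?R has_vector_derivative E) (at 0)"
    by (auto intro!: derivative_eq_intros)
  have "bounded_linear (transpose :: real^'k^'n \<Rightarrow> real^'n^'k)"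
    by (intro linear_conv_bounded_linear[THEN iffD1] linearI)
      (simp_all add: transpose_def vec_eq_iff)
  then have "((\<lambda>t. transpose (?R t)) has_vector_derivative transpose E) (at 0)"
    using R by (rule bounded_linear.has_vector_derivative)
  then have "((\<lambda>t. transpose (?R t) ** A) has_vector_derivative transpose E ** A) (at 0)"
    using bounded_bilinear.has_vector_derivative[OF bounded_bilinear_matrix_mult _
        has_vector_derivative_const, of "\<lambda>t. transpose (?R t)" "transpose E" 0 UNIV A] by simp
  then have "((\<lambda>t. transpose (?R t) ** A ** ?R t) has_vector_derivative
      transpose P ** A ** E + transpose E ** A ** P) (at 0)"
    using bounded_bilinear.has_vector_derivative[OF bounded_bilinear_matrix_mult _ R] by force
  from has_real_derivative_trace_matpow[OF this, of "Suc m"]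
  have "((\<lambda>t. trpow A (Suc m) (?R t)) has_real_derivative real (Suc m) *
      trace (matpow (transpose P ** A ** P) m ** (transpose P ** A ** E + transpose E ** A ** P))) (at 0)"
    by (simp add: trpow_def)
  moreover have "trace (matpow (transpose P ** A ** P) m ** (transpose P ** A ** E)) = X $ i $ j"
  proof -
    \<comment> \<open>Symmetry of \<open>A\<close> reduces this term to the other one by
      transposition, which preserves the trace.\<close>
    have "transpose (matpow (transpose P ** A ** P) m ** (transpose P ** A ** E)) = transpose E ** X"
      by (simp add: X_def matrix_transpose_mul transpose_matpow tA matrix_mul_assoc)
    then show ?thesis by (metis E_def trace_transpose trace_transpose_unit_mult)
  qed
  moreover have "trace (matpow (transpose P ** A ** P) m ** (transpose E ** A ** P)) = X $ i $ j"
  proof -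
    have "trace (matpow (transpose P ** A ** P) m ** (transpose E ** A ** P)) = trace (transpose E ** X)"
      by (subst trace_mul_sym) (simp add: X_def matrix_mul_assoc)
    then show ?thesis by (simp add: E_def trace_transpose_unit_mult)
  qed
  ultimately show "((\<lambda>t. trpow A (Suc m) (P + t *\<^sub>R axis i (axis j 1))) has_real_derivative
      (H_fun A (Suc m) P ** P) $ i $ j) (at 0)"
    by (simp add: H_fun_mult matrix_add_ldistrib trace_add mult_ac flip: E_def X_def del: of_nat_Suc)
qed

lemma has_partials_g_fun:
  fixes A :: "real^'n^'n" and P :: "real^'k^'n"
  assumes A: "psd_matrix A" and s: "1 < s"
  shows "has_partials (g_fun A (Suc m) s) (Hg_fun A (Suc m) s P ** P) P"
  unfolding has_partials_def
proof (intro allI)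
  fix i j
  have "has_partials (trpow A (Suc m)) (H_fun A (Suc m) P ** P) P"
    using A by (intro has_partials_trpow) (simp add: psd_matrix_def)
  then have "((\<lambda>t. trpow A (Suc m) (P + t *\<^sub>R axis i (axis j 1))) has_real_derivative
      (H_fun A (Suc m) P ** P) $ i $ j) (at 0)"
    by (simp add: has_partials_def)
  from has_real_derivative_powr_nonneg[OF this trpow_nonneg[OF A] s]
  show "((\<lambda>t. g_fun A (Suc m) s (P + t *\<^sub>R axis i (axis j 1))) has_real_derivative
      (Hg_fun A (Suc m) s P ** P) $ i $ j) (at 0)"
    by (simp add: g_fun_def Hg_fun_def scalar_matrix_assoc[symmetric])
qed

section \<open>Verification of the atomic conditions\<close>

lemma atomic_NEPv_with_g_fun:
  fixes A :: "real^'n^'n"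
  assumes A: "psd_matrix A" and s: "1 < s"
  shows "atomic_NEPv_with UNIV (g_fun A (Suc m) s :: real^'k^'n \<Rightarrow> real) (Hg_fun A (Suc m) s) stiefel
    2 (2 * (s * real (Suc m) - 1))"
  unfolding atomic_NEPv_with_def
proof (intro conjI ballI)
  show "\<exists>\<delta>>0. stiefel_nbhd \<delta> \<subseteq> (UNIV :: (real^'k^'n) set)"
    by (auto intro: exI[of _ 1])
  show "symmetric_matrix (Hg_fun A (Suc m) s P)" for P :: "real^'k^'n"
    using symmetric_matrix_H_fun[of A "Suc m" P] A
    by (simp add: psd_matrix_def symmetric_matrix_def Hg_fun_def transpose_def vec_eq_iff)
  have "1 * 1 \<le> s * real (Suc m)"
    using s by (intro mult_mono) auto
  then show "0 \<le> 2 * (s * real (Suc m) - 1)" by simp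
  \<comment> \<open>The two constants add up to the factor 2 s (m + 1) of
    \<open>trace_Hg_fun_self\<close>.\<close>
  show "atomic_cond1 (g_fun A (Suc m) s :: real^'k^'n \<Rightarrow> real) (Hg_fun A (Suc m) s) stiefel
      2 (2 * (s * real (Suc m) - 1))"
    unfolding atomic_cond1_def g_fun_def trace_Hg_fun_self[OF A] by (simp add: algebra_simps)
  \<comment> \<open>The trace bound involves \<open>P'\<close> itself and \<open>PP\<close> is all
    of \<open>stiefel\<close>, so Q can be the identity.\<close>
  have "mat 1 \<in> (stiefel :: (real^'k^'k) set)"
    by (simp add: stiefel_def transpose_mat)
  then show "atomic_cond2 (g_fun A (Suc m) s :: real^'k^'n \<Rightarrow> real) (Hg_fun A (Suc m) s) stiefel
      2 (2 * (s * real (Suc m) - 1))"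
    unfolding atomic_cond2_def g_fun_def using trace_Hg_fun_le[OF A s]
    by (intro ballI bexI[of _ "mat 1"]) simp_all
qed auto

theorem corollary7p2:
  fixes A :: "real^'n^'n" and m :: nat and s :: real
  assumes "CARD('k::finite) \<le> CARD('n)"
    and "psd_matrix A"
    and "m \<ge> 1"
    and "s > 1"
  shows "(\<forall>P :: real^'k^'n. has_partials (g_fun A m s) (Hg_fun A m s P ** P) P) \<and>
    (\<forall>P :: real^'k^'n.
       trace (transpose P ** Hg_fun A m s P ** P)
         = 2 * s * real m * trace (matpow (transpose P ** A ** P) m) powr s) \<and>
    (\<forall>(P :: real^'k^'n) (P' :: real^'k^'n).
       trace (transpose P' ** Hg_fun A m s P ** P')
         \<le> 2 * trace (matpow (transpose P' ** A ** P') m) powr s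
           + 2 * (s * real m - 1) * trace (matpow (transpose P ** A ** P) m) powr s) \<and>
    atomic_NEPv_with UNIV (g_fun A m s :: real^'k^'n \<Rightarrow> real) (Hg_fun A m s) stiefel
      2 (2 * (s * real m - 1)) \<and>
    atomic_NEPv UNIV (g_fun A m s :: real^'k^'n \<Rightarrow> real)"
proof -
  \<comment> \<open>As a successor, \<open>m\<close> turns the truncated \<open>m - 1\<close> in
    \<open>H_fun\<close> into \<open>j\<close>.\<close>
  obtain j where m: "m = Suc j"
    using \<open>m \<ge> 1\<close> by (cases m) auto
  have atomic: "atomic_NEPv_with UNIV (g_fun A m s :: real^'k^'n \<Rightarrow> real) (Hg_fun A m s) stiefel
      2 (2 * (s * real m - 1))"
    unfolding m by (rule atomic_NEPv_with_g_fun[OF assms(2,4)])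
  then have "atomic_NEPv UNIV (g_fun A m s :: real^'k^'n \<Rightarrow> real)"
    unfolding atomic_NEPv_def by blast
  with atomic show ?thesis
    using has_partials_g_fun[OF assms(2,4)] trace_Hg_fun_self[OF assms(2)]
      trace_Hg_fun_le[OF assms(2,4)]
    unfolding m trpow_def by blast
qed

end
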